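(* Fix $1<q<+\infty$ and let $B_q\ge1$ be the constant from the Helmholtz decomposition in $L^q$. Then for all $u\in\dot W^{1,q}_{df}(\mathbb{R}^3)$, $$\frac{1}{2B_q}\|\omega_h\|_{L^q}\le\|v^3\|_{L^q}\le2B_q\|\omega_h\|_{L^q}.$$
   Context: Helmholtz decomposition: for $1<q<+\infty$, every $v\in L^q(\mathbb{R}^3;\mathbb{R}^3)$ has a unique decomposition $v=w+\nabla f$ with $w,\nabla f\in L^q(\mathbb{R}^3;\mathbb{R}^3)$ and $\nabla\cdot w=0$ (in the distributional sense; $\nabla f$ is a gradient in the sense that it is orthogonal to all compactly supported smooth divergence free test fields), and there is a constant $B_q\ge1$, depending only on $q$, such that $\|w\|_{L^q}\le B_q\|v\|_{L^q}$ and $\|\nabla f\|_{L^q}\le B_q\|v\|_{L^q}$ for all $v$. $\dot W^{1,q}_{df}(\mathbb{R}^3)$ denotes the divergence free vector fields $u:\mathbb{R}^3\to\mathbb{R}^3$ in the homogeneous Sobolev space, i.e. with weak gradient $\nabla u\in L^q$. For such $u$: $\omega=\nabla\times u$, $\omega_h=(\omega_1,\omega_2,0)$, and $v^3=\partial_3u+\nabla u_3$. *)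

theory Defs
  imports "HOL-Analysis.Analysis"
begin

section \<open>The spaces \<open>L\<^sup>q\<close>\<close>

text \<open>
  Functions rather than almost-everywhere classes are used throughout; values are measured
  pointwise by the Euclidean norm of the codomain.
\<close>

definition Lq :: "real \<Rightarrow> (real^3 \<Rightarrow> 'b::euclidean_space) set" where
  "Lq q = {f. f \<in> borel_measurable lebesgue \<and> integrable lebesgue (\<lambda>x. norm (f x) powr q)}"

text \<open>Meaningful only for \<open>f \<in> Lq q\<close>: the Bochner integral of a non-integrable function is 0.\<close>

definition Lq_norm :: "real \<Rightarrow> (real^3 \<Rightarrow> 'b::euclidean_space) \<Rightarrow> real" where
  "Lq_norm q f = (\<integral>x. norm (f x) powr q \<partial>lebesgue) powr (1 / q)"

definition locally_integrable :: "(real^3 \<Rightarrow> 'b::euclidean_space) \<Rightarrow> bool" where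
  "locally_integrable f \<longleftrightarrow> (\<forall>K. compact K \<longrightarrow> set_integrable lebesgue K f)"


section \<open>Test functions\<close>

definition partial_deriv :: "3 \<Rightarrow> (real^3 \<Rightarrow> 'b::euclidean_space) \<Rightarrow> real^3 \<Rightarrow> 'b" where
  "partial_deriv j f x = frechet_derivative f (at x) (axis j 1)"

primrec Ck :: "nat \<Rightarrow> (real^3 \<Rightarrow> 'b::euclidean_space) \<Rightarrow> bool" where
  "Ck 0 f \<longleftrightarrow> continuous_on UNIV f"
| "Ck (Suc k) f \<longleftrightarrow> (\<forall>x. f differentiable (at x)) \<and> (\<forall>j. Ck k (partial_deriv j f))"

definition test_functions :: "(real^3 \<Rightarrow> 'b::euclidean_space) set" where
  "test_functions = {\<phi>. (\<forall>k. Ck k \<phi>) \<and> compact (closure {x. \<phi> x \<noteq> 0})}"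

definition gradient :: "(real^3 \<Rightarrow> real) \<Rightarrow> real^3 \<Rightarrow> real^3" where
  "gradient \<phi> x = (\<chi> j. partial_deriv j \<phi> x)"

definition divergence :: "(real^3 \<Rightarrow> real^3) \<Rightarrow> real^3 \<Rightarrow> real" where
  "divergence \<psi> x = (\<Sum>j\<in>UNIV. partial_deriv j \<psi> x $ j)"


section \<open>Weak derivatives\<close>

definition has_weak_partial :: "3 \<Rightarrow> (real^3 \<Rightarrow> real) \<Rightarrow> (real^3 \<Rightarrow> real) \<Rightarrow> bool" where
  "has_weak_partial j f g \<longleftrightarrow>
     locally_integrable f \<and> locally_integrable g \<and>
     (\<forall>\<phi>\<in>test_functions.
        (\<integral>x. f x * partial_deriv j \<phi> x \<partial>lebesgue) = - (\<integral>x. g x * \<phi> x \<partial>lebesgue))"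

text \<open>
  Weak derivatives are unique almost everywhere, so the choice only fixes a representative.
\<close>

definition weak_partial :: "3 \<Rightarrow> (real^3 \<Rightarrow> real) \<Rightarrow> real^3 \<Rightarrow> real" where
  "weak_partial j f = (SOME g. has_weak_partial j f g)"

definition weak_partial_vec :: "3 \<Rightarrow> (real^3 \<Rightarrow> real^3) \<Rightarrow> real^3 \<Rightarrow> real^3" where
  "weak_partial_vec j u x = (\<chi> i. weak_partial j (\<lambda>y. u y $ i) x)"

definition weak_gradient :: "(real^3 \<Rightarrow> real) \<Rightarrow> real^3 \<Rightarrow> real^3" where
  "weak_gradient f x = (\<chi> j. weak_partial j f x)"

definition weak_jacobian :: "(real^3 \<Rightarrow> real^3) \<Rightarrow> real^3 \<Rightarrow> real^3^3" where
  "weak_jacobian u x = (\<chi> i j. weak_partial j (\<lambda>y. u y $ i) x)"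

definition weak_curl :: "(real^3 \<Rightarrow> real^3) \<Rightarrow> real^3 \<Rightarrow> real^3" where
  "weak_curl u x =
     vector [weak_partial 2 (\<lambda>y. u y $ 3) x - weak_partial 3 (\<lambda>y. u y $ 2) x,
             weak_partial 3 (\<lambda>y. u y $ 1) x - weak_partial 1 (\<lambda>y. u y $ 3) x,
             weak_partial 1 (\<lambda>y. u y $ 2) x - weak_partial 2 (\<lambda>y. u y $ 1) x]"

definition weakly_div_free :: "(real^3 \<Rightarrow> real^3) \<Rightarrow> bool" where
  "weakly_div_free w \<longleftrightarrow>
     (\<forall>\<phi>\<in>test_functions. (\<integral>x. w x \<bullet> gradient \<phi> x \<partial>lebesgue) = 0)"

text \<open>Gradient fields, understood as the fields that annihilate all solenoidal test fields.\<close>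

definition gradient_field :: "(real^3 \<Rightarrow> real^3) \<Rightarrow> bool" where
  "gradient_field g \<longleftrightarrow>
     (\<forall>\<psi>\<in>test_functions. (\<forall>x. divergence \<psi> x = 0) \<longrightarrow> (\<integral>x. g x \<bullet> \<psi> x \<partial>lebesgue) = 0)"


section \<open>The Helmholtz decomposition\<close>

text \<open>In \<open>v = w + g\<close>, the field \<open>g\<close> plays the role of \<open>\<nabla>f\<close>.\<close>

definition helmholtz_decomp ::
  "real \<Rightarrow> (real^3 \<Rightarrow> real^3) \<Rightarrow> (real^3 \<Rightarrow> real^3) \<Rightarrow> (real^3 \<Rightarrow> real^3) \<Rightarrow> bool" where
  "helmholtz_decomp q v w g \<longleftrightarrow>
     w \<in> Lq q \<and> g \<in> Lq q \<and> weakly_div_free w \<and> gradient_field g \<and>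
     (AE x in lebesgue. v x = w x + g x)"

text \<open>
  \<open>B\<close> is an admissible value of \<open>B\<^sub>q\<close> in the Helmholtz decomposition theorem in \<open>L\<^sup>q\<close>:
  every field in \<open>L\<^sup>q\<close> has a decomposition, unique almost everywhere, whose two parts are
  bounded by \<open>B\<close> times the norm of the field.
\<close>

definition helmholtz_const :: "real \<Rightarrow> real \<Rightarrow> bool" where
  "helmholtz_const q B \<longleftrightarrow>
     B \<ge> 1 \<and>
     (\<forall>v\<in>Lq q.
        (\<exists>w g. helmholtz_decomp q v w g \<and>
           Lq_norm q w \<le> B * Lq_norm q v \<and>
           Lq_norm q g \<le> B * Lq_norm q v \<and>
           (\<forall>w' g'. helmholtz_decomp q v w' g' \<longrightarrow>
              (AE x in lebesgue. w' x = w x) \<and> (AE x in lebesgue. g' x = g x))))"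


section \<open>The homogeneous Sobolev space and the fields derived from \<open>u\<close>\<close>

definition hom_sobolev_df :: "real \<Rightarrow> (real^3 \<Rightarrow> real^3) set" where
  "hom_sobolev_df q =
     {u. locally_integrable u \<and>
         (\<forall>i j. \<exists>g. has_weak_partial j (\<lambda>x. u x $ i) g) \<and>
         weak_jacobian u \<in> Lq q \<and>
         weakly_div_free u}"

definition omega_h :: "(real^3 \<Rightarrow> real^3) \<Rightarrow> real^3 \<Rightarrow> real^3" where
  "omega_h u x = vector [weak_curl u x $ 1, weak_curl u x $ 2, 0]"

definition v3 :: "(real^3 \<Rightarrow> real^3) \<Rightarrow> real^3 \<Rightarrow> real^3" where
  "v3 u x = weak_partial_vec 3 u x + weak_gradient (\<lambda>y. u y $ 3) x"

end

theory Submission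
  imports Defs
begin

text \<open>
  The two summands of \<open>v\<^sup>3 = P + G\<close>, with \<open>P = \<partial>\<^sub>3u\<close> and \<open>G = \<nabla>u\<^sub>3\<close>, are of the two types that
  occur in a Helmholtz decomposition: \<open>P\<close> is solenoidal because \<open>u\<close> is, and \<open>G\<close> is a gradient.
  The difference of the same two fields is
  \<open>P - G = (\<partial>\<^sub>3u\<^sub>1 - \<partial>\<^sub>1u\<^sub>3, \<partial>\<^sub>3u\<^sub>2 - \<partial>\<^sub>2u\<^sub>3, 0) = (\<omega>\<^sub>2, -\<omega>\<^sub>1, 0)\<close>,
  a rotation of \<open>\<omega>\<^sub>h\<close> by a right angle, hence of the same length at every point.

  So \<open>P + G\<close> and \<open>P + (-G)\<close> are the Helmholtz decompositions of \<open>v\<^sup>3\<close> and of a field as large as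
  \<open>\<omega>\<^sub>h\<close>. By uniqueness the parts \<open>P\<close> and \<open>\<plusminus>G\<close> are bounded by \<open>B\<^sub>q\<close> times the norm of either
  field, and so either field is bounded by \<open>2B\<^sub>q\<close> times the norm of the other
  (\<open>Lq_norm_plus_le_minus\<close>).

  The analytic content is the weak form of the two claims about \<open>P\<close> and \<open>G\<close>
  (\<open>weakly_div_free_weak_partial\<close>, \<open>gradient_field_weak_gradient\<close>). Both move a derivative onto the
  test field; the first also exchanges two derivatives of the test function, which is Schwarz's
  theorem (\<open>partial_deriv_commute\<close>).
\<close>

section \<open>Partial derivatives of smooth functions\<close>

lemma has_real_derivative_along_axis:
  fixes f :: "real^3 \<Rightarrow> real"
  assumes "f differentiable (at (x + s *\<^sub>R axis j 1))"
  shows "((\<lambda>s. f (x + s *\<^sub>R axis j 1)) has_real_derivative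
           partial_deriv j f (x + s *\<^sub>R axis j 1)) (at s)"
proof -
  let ?D = "frechet_derivative f (at (x + s *\<^sub>R axis j 1))"
  have f: "(f has_derivative ?D) (at (x + s *\<^sub>R axis j 1))"
    using assms frechet_derivative_works by blast
  have "((\<lambda>s. x + s *\<^sub>R axis j 1) has_derivative (\<lambda>h. h *\<^sub>R axis j 1)) (at s)"
    by (auto intro!: derivative_eq_intros)
  from has_derivative_compose[OF this f]
  have "((\<lambda>s. f (x + s *\<^sub>R axis j 1)) has_derivative (\<lambda>h. ?D (h *\<^sub>R axis j 1))) (at s)" .
  moreover have "?D (h *\<^sub>R axis j 1) = partial_deriv j f (x + s *\<^sub>R axis j 1) * h" for h
    using linear_scale[OF has_derivative_linear[OF f]] by (simp add: partial_deriv_def)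
  ultimately show ?thesis
    by (simp add: has_field_derivative_def)
qed

text \<open>
  The mean value theorem, applied once in each direction, expresses the second difference as a mixed
  derivative. The left-hand side is symmetric in \<open>i\<close> and \<open>j\<close>, the order of differentiation on the
  right is not; this is what forces the two orders to agree.
\<close>

lemma second_difference_mean_value:
  fixes f :: "real^3 \<Rightarrow> real" and x :: "real^3"
  assumes f: "\<And>x. f differentiable (at x)" and fi: "\<And>x. partial_deriv i f differentiable (at x)"
    and "0 < h"
  obtains s t where "0 < s" "s < h" "0 < t" "t < h"
    "f (x + h *\<^sub>R axis i 1 + h *\<^sub>R axis j 1) - f (x + h *\<^sub>R axis i 1) - f (x + h *\<^sub>R axis j 1) + f x
       = h\<^sup>2 * partial_deriv j (partial_deriv i f) (x + s *\<^sub>R axis i 1 + t *\<^sub>R axis j 1)"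
proof -
  let ?d = "\<lambda>s. f (x + h *\<^sub>R axis j 1 + s *\<^sub>R axis i 1) - f (x + s *\<^sub>R axis i 1)"
  let ?d' = "\<lambda>s. partial_deriv i f (x + h *\<^sub>R axis j 1 + s *\<^sub>R axis i 1)
                  - partial_deriv i f (x + s *\<^sub>R axis i 1)"
  have "(?d has_real_derivative ?d' s) (at s)" for s
    by (intro DERIV_diff has_real_derivative_along_axis f)
  from MVT2[OF \<open>0 < h\<close> this]
  obtain s where s: "0 < s" "s < h" "?d h - ?d 0 = h * ?d' s"
    by auto
  have "((\<lambda>t. partial_deriv i f (x + s *\<^sub>R axis i 1 + t *\<^sub>R axis j 1)) has_real_derivative
          partial_deriv j (partial_deriv i f) (x + s *\<^sub>R axis i 1 + t *\<^sub>R axis j 1)) (at t)" for t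
    by (intro has_real_derivative_along_axis fi)
  from MVT2[OF \<open>0 < h\<close> this]
  obtain t where t: "0 < t" "t < h"
    "partial_deriv i f (x + s *\<^sub>R axis i 1 + h *\<^sub>R axis j 1) - partial_deriv i f (x + s *\<^sub>R axis i 1)
       = h * partial_deriv j (partial_deriv i f) (x + s *\<^sub>R axis i 1 + t *\<^sub>R axis j 1)"
    by auto
  show thesis
    using s t by (intro that[of s t]) (simp_all add: algebra_simps power2_eq_square)
qed

lemma second_difference_tendsto:
  fixes f :: "real^3 \<Rightarrow> real" and x :: "real^3"
  assumes f: "\<And>x. f differentiable (at x)" and fi: "\<And>x. partial_deriv i f differentiable (at x)"
    and cont: "continuous_on UNIV (partial_deriv j (partial_deriv i f))"
  shows "((\<lambda>h. (f (x + h *\<^sub>R axis i 1 + h *\<^sub>R axis j 1) - f (x + h *\<^sub>R axis i 1)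
                 - f (x + h *\<^sub>R axis j 1) + f x) / h\<^sup>2)
           \<longlongrightarrow> partial_deriv j (partial_deriv i f) x) (at_right 0)"
    (is "(?Q \<longlongrightarrow> ?p x) _")
proof (rule tendstoI)
  fix e :: real assume "0 < e"
  have "continuous (at x) ?p"
    using cont by (simp add: continuous_on_eq_continuous_at)
  then obtain d where d: "0 < d" "\<And>y. dist y x < d \<Longrightarrow> dist (?p y) (?p x) < e"
    using \<open>0 < e\<close> unfolding continuous_at_eps_delta by blast
  have "dist (?Q h) (?p x) < e" if "0 < h" "h < d / 2" for h
  proof -
    obtain s t where st: "0 < s" "s < h" "0 < t" "t < h"
      "?Q h = ?p (x + s *\<^sub>R axis i 1 + t *\<^sub>R axis j 1)"
      using second_difference_mean_value[of f i h x j, OF f fi \<open>0 < h\<close>] \<open>0 < h\<close>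
      by (metis nonzero_mult_div_cancel_left less_irrefl zero_less_power)
    have "dist (x + s *\<^sub>R axis i 1 + t *\<^sub>R axis j 1) x \<le> norm (s *\<^sub>R axis i (1::real)) + norm (t *\<^sub>R axis j (1::real))"
      by (simp add: dist_norm add.assoc norm_triangle_ineq del: norm_scaleR)
    also have "\<dots> < d"
      using st that by (simp add: norm_axis_1)
    finally show ?thesis
      using d(2) st(5) by simp
  qed
  then show "\<forall>\<^sub>F h in at_right 0. dist (?Q h) (?p x) < e"
    using \<open>0 < d\<close> by (auto simp: eventually_at_right_field intro!: exI[of _ "d/2"])
qed

lemma partial_deriv_commute:
  fixes f :: "real^3 \<Rightarrow> real"
  assumes "Ck 2 f"
  shows "partial_deriv i (partial_deriv j f) x = partial_deriv j (partial_deriv i f) x"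
proof -
  have C2: "f differentiable (at x)" "partial_deriv k f differentiable (at x)"
    "continuous_on UNIV (partial_deriv l (partial_deriv k f))" for k l x
    using assms by (simp_all add: numeral_2_eq_2)
  let ?Q = "\<lambda>i j h. (f (x + h *\<^sub>R axis i 1 + h *\<^sub>R axis j 1) - f (x + h *\<^sub>R axis i 1)
                    - f (x + h *\<^sub>R axis j 1) + f x) / h\<^sup>2"
  have "?Q i j = ?Q j i"
    by (simp add: fun_eq_iff algebra_simps)
  moreover have lim: "(?Q i j \<longlongrightarrow> partial_deriv j (partial_deriv i f) x) (at_right 0)" for i j
    by (rule second_difference_tendsto[OF C2])
  ultimately have "(?Q i j \<longlongrightarrow> partial_deriv i (partial_deriv j f) x) (at_right 0)"
    by (simp only: lim)
  from tendsto_unique[OF trivial_limit_at_right_real this lim] show ?thesis .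
qed

section \<open>Test functions\<close>

lemma partial_deriv_component:
  fixes \<psi> :: "real^3 \<Rightarrow> real^3"
  assumes "\<psi> differentiable (at x)"
  shows "partial_deriv j (\<lambda>y. \<psi> y $ i) x = partial_deriv j \<psi> x $ i"
proof -
  have "((\<lambda>y. \<psi> y $ i) has_derivative (\<lambda>h. frechet_derivative \<psi> (at x) h $ i)) (at x)"
    using assms by (intro bounded_linear.has_derivative[OF bounded_linear_vec_nth])
      (simp add: frechet_derivative_works[symmetric])
  from frechet_derivative_at[OF this] show ?thesis
    unfolding partial_deriv_def by metis
qed

lemma Ck_component:
  fixes \<psi> :: "real^3 \<Rightarrow> real^3"
  shows "Ck k \<psi> \<Longrightarrow> Ck k (\<lambda>y. \<psi> y $ i)"
proof (induction k arbitrary: \<psi>)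
  case 0
  then show ?case by (auto intro!: continuous_intros)
next
  case (Suc k)
  have diff: "\<psi> differentiable (at x)" for x
    using Suc.prems by simp
  then have "(\<lambda>y. \<psi> y $ i) differentiable (at x)" for x
    unfolding differentiable_def
    by (blast intro: bounded_linear.has_derivative[OF bounded_linear_vec_nth])
  moreover have "partial_deriv j (\<lambda>y. \<psi> y $ i) = (\<lambda>y. partial_deriv j \<psi> y $ i)" for j
    using diff by (simp add: fun_eq_iff partial_deriv_component)
  ultimately show ?case
    using Suc by simp
qed

lemma test_functionsD:
  assumes "\<phi> \<in> test_functions"
  shows "Ck k \<phi>" "\<phi> differentiable (at x)" "continuous_on UNIV \<phi>"
    "compact (closure {x. \<phi> x \<noteq> 0})"
proof -
  have Ck: "Ck k \<phi>" for k
    using assms by (simp add: test_functions_def)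
  from Ck[of k] Ck[of "Suc 0"] Ck[of 0]
  show "Ck k \<phi>" "\<phi> differentiable (at x)" "continuous_on UNIV \<phi>"
    by simp_all
  show "compact (closure {x. \<phi> x \<noteq> 0})"
    using assms by (simp add: test_functions_def)
qed

lemma test_functions_component:
  fixes \<psi> :: "real^3 \<Rightarrow> real^3"
  assumes "\<psi> \<in> test_functions"
  shows "(\<lambda>y. \<psi> y $ i) \<in> test_functions"
proof -
  have "closure {x. \<psi> x $ i \<noteq> 0} \<subseteq> closure {x. \<psi> x \<noteq> 0}"
    by (intro closure_mono) auto
  then have "compact (closure {x. \<psi> x $ i \<noteq> 0})"
    using test_functionsD(4)[OF assms]
    by (metis Int_absorb1 closed_closure compact_Int_closed)
  then show ?thesis
    using test_functionsD(1)[OF assms] by (simp add: test_functions_def Ck_component)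
qed

lemma test_functions_partial_deriv:
  assumes "\<phi> \<in> test_functions"
  shows "partial_deriv j \<phi> \<in> test_functions"
proof -
  let ?S = "{x. \<phi> x \<noteq> 0}"
  have "partial_deriv j \<phi> x = 0" if "x \<notin> closure ?S" for x
  proof -
    have "(\<phi> has_derivative (\<lambda>h. 0)) (at x)"
    proof (rule has_derivative_transform_within_open)
      show "((\<lambda>x. 0) has_derivative (\<lambda>h. 0)) (at x)" "open (- closure ?S)"
        "x \<in> - closure ?S"
        using that by (simp_all add: open_Compl)
      show "0 = \<phi> y" if "y \<in> - closure ?S" for y
        using that closure_subset[of ?S] by (metis (mono_tags, lifting) ComplD mem_Collect_eq subsetD)
    qed
    from frechet_derivative_at[OF this] show ?thesis
      unfolding partial_deriv_def by metis
  qed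
  then have "closure {x. partial_deriv j \<phi> x \<noteq> 0} \<subseteq> closure ?S"
    by (intro closure_minimal) auto
  then have "compact (closure {x. partial_deriv j \<phi> x \<noteq> 0})"
    using test_functionsD(4)[OF assms]
    by (metis Int_absorb1 closed_closure compact_Int_closed)
  moreover have "Ck k (partial_deriv j \<phi>)" for k
    using test_functionsD(1)[OF assms, of "Suc k"] by simp
  ultimately show ?thesis
    by (simp add: test_functions_def)
qed

lemma integrable_mult_test_function:
  fixes f \<phi> :: "real^3 \<Rightarrow> real"
  assumes f: "locally_integrable f" and \<phi>: "\<phi> \<in> test_functions"
  shows "integrable lebesgue (\<lambda>x. f x * \<phi> x)"
proof -
  define K where "K = closure {x. \<phi> x \<noteq> 0}"
  have K: "compact K" "\<And>x. x \<notin> K \<Longrightarrow> \<phi> x = 0"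
    using test_functionsD(4)[OF \<phi>] closure_subset[of "{x. \<phi> x \<noteq> 0}"] by (auto simp: K_def)
  have fK: "integrable lebesgue (\<lambda>x. indicator K x *\<^sub>R f x)"
    using f K(1) by (simp add: locally_integrable_def set_integrable_def)
  have "continuous_on K \<phi>"
    using test_functionsD(3)[OF \<phi>] continuous_on_subset by blast
  from compact_imp_bounded[OF compact_continuous_image[OF this K(1)]]
  obtain C where C: "\<And>x. x \<in> K \<Longrightarrow> \<bar>\<phi> x\<bar> \<le> C"
    by (auto simp: bounded_iff)
  have "\<phi> \<in> borel_measurable lebesgue"
    using test_functionsD(3)[OF \<phi>]
    by (intro measurable_completion) (simp add: borel_measurable_continuous_onI)
  then have "integrable lebesgue (\<lambda>x. (indicator K x *\<^sub>R f x) * \<phi> x)"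
  proof (intro Bochner_Integration.integrable_bound[OF integrable_mult_right[OF fK, of C]] AE_I2)
    show "norm ((indicator K x *\<^sub>R f x) * \<phi> x) \<le> norm (C * (indicator K x *\<^sub>R f x))" for x
    proof (cases "x \<in> K")
      case True
      then have "\<bar>\<phi> x\<bar> \<le> \<bar>C\<bar>" using C[of x] by linarith
      then show ?thesis
        using True by (simp add: abs_mult mult.commute mult_right_mono)
    qed simp
  qed (use fK in measurable)
  moreover have "(\<lambda>x. (indicator K x *\<^sub>R f x) * \<phi> x) = (\<lambda>x. f x * \<phi> x)"
    using K(2) by (auto simp: fun_eq_iff indicator_def)
  ultimately show ?thesis by simp
qed

section \<open>Weakly solenoidal fields and weak gradients\<close>

text \<open>
  For a test function \<open>\<phi>\<close>, integration by parts turns \<open>\<integral> \<partial>\<^sub>ju \<bullet> \<nabla>\<phi>\<close> into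
  \<open>- \<integral> u \<bullet> \<partial>\<^sub>j\<nabla>\<phi>\<close>, and \<open>\<partial>\<^sub>j\<nabla>\<phi> = \<nabla>\<partial>\<^sub>j\<phi>\<close> is the gradient of another test function.
\<close>

lemma weakly_div_free_weak_partial:
  assumes u: "weakly_div_free u"
    and p: "\<And>i. has_weak_partial j (\<lambda>x. u x $ i) (\<lambda>x. p x $ i)"
  shows "weakly_div_free p"
  unfolding weakly_div_free_def
proof
  fix \<phi> :: "real^3 \<Rightarrow> real" assume \<phi>: "\<phi> \<in> test_functions"
  have loc: "locally_integrable (\<lambda>x. u x $ i)" "locally_integrable (\<lambda>x. p x $ i)" for i
    using p[of i] unfolding has_weak_partial_def by blast+
  have parts: "(\<integral>x. u x $ i * partial_deriv j \<eta> x \<partial>lebesgue) = - (\<integral>x. p x $ i * \<eta> x \<partial>lebesgue)"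
    if "\<eta> \<in> test_functions" for i \<eta>
    using p[of i] that unfolding has_weak_partial_def by blast
  note d\<phi> = test_functions_partial_deriv[OF \<phi>]
  have commute: "partial_deriv j (partial_deriv i \<phi>) x = partial_deriv i (partial_deriv j \<phi>) x" for i x
    by (rule partial_deriv_commute[OF test_functionsD(1)[OF \<phi>]])
  have "(\<integral>x. p x \<bullet> gradient \<phi> x \<partial>lebesgue)
      = (\<Sum>i\<in>UNIV. \<integral>x. p x $ i * partial_deriv i \<phi> x \<partial>lebesgue)"
    unfolding inner_vec_def gradient_def
    by (simp add: Bochner_Integration.integral_sum integrable_mult_test_function loc d\<phi>)
  also have "\<dots> = (\<Sum>i\<in>UNIV. - (\<integral>x. u x $ i * partial_deriv j (partial_deriv i \<phi>) x \<partial>lebesgue))"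
    by (simp only: parts[OF d\<phi>] minus_minus)
  also have "\<dots> = - (\<Sum>i\<in>UNIV. \<integral>x. u x $ i * partial_deriv i (partial_deriv j \<phi>) x \<partial>lebesgue)"
    by (simp only: sum_negf commute)
  also have "\<dots> = - (\<integral>x. u x \<bullet> gradient (partial_deriv j \<phi>) x \<partial>lebesgue)"
    unfolding inner_vec_def gradient_def
    by (simp add: Bochner_Integration.integral_sum integrable_mult_test_function loc
        test_functions_partial_deriv[OF d\<phi>])
  also have "\<dots> = 0"
    using u d\<phi> by (simp add: weakly_div_free_def)
  finally show "(\<integral>x. p x \<bullet> gradient \<phi> x \<partial>lebesgue) = 0" .
qed

lemma gradient_field_weak_gradient:
  assumes g: "\<And>j. has_weak_partial j f (\<lambda>x. g x $ j)"
  shows "gradient_field g"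
  unfolding gradient_field_def
proof (intro ballI impI)
  fix \<psi> :: "real^3 \<Rightarrow> real^3"
  assume \<psi>: "\<psi> \<in> test_functions" and div: "\<forall>x. divergence \<psi> x = 0"
  have loc: "locally_integrable f" "locally_integrable (\<lambda>x. g x $ j)" for j
    using g[of j] unfolding has_weak_partial_def by blast+
  have parts: "(\<integral>x. f x * partial_deriv j \<eta> x \<partial>lebesgue) = - (\<integral>x. g x $ j * \<eta> x \<partial>lebesgue)"
    if "\<eta> \<in> test_functions" for j \<eta>
    using g[of j] that unfolding has_weak_partial_def by blast
  note \<psi>i = test_functions_component[OF \<psi>]
  have "(\<integral>x. g x \<bullet> \<psi> x \<partial>lebesgue) = (\<Sum>j\<in>UNIV. \<integral>x. g x $ j * \<psi> x $ j \<partial>lebesgue)"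
    unfolding inner_vec_def
    by (simp add: Bochner_Integration.integral_sum integrable_mult_test_function loc \<psi>i)
  also have "\<dots> = (\<Sum>j\<in>UNIV. - (\<integral>x. f x * partial_deriv j (\<lambda>y. \<psi> y $ j) x \<partial>lebesgue))"
    by (simp only: parts[OF \<psi>i] minus_minus)
  also have "\<dots> = - (\<integral>x. (\<Sum>j\<in>UNIV. f x * partial_deriv j (\<lambda>y. \<psi> y $ j) x) \<partial>lebesgue)"
    by (simp add: sum_negf Bochner_Integration.integral_sum integrable_mult_test_function loc
        test_functions_partial_deriv[OF \<psi>i])
  also have "\<dots> = - (\<integral>x. f x * divergence \<psi> x \<partial>lebesgue)"
    unfolding divergence_def
    by (simp add: sum_distrib_left partial_deriv_component[OF test_functionsD(2)[OF \<psi>]])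
  also have "\<dots> = 0"
    using div by simp
  finally show "(\<integral>x. g x \<bullet> \<psi> x \<partial>lebesgue) = 0" .
qed

lemma gradient_field_minus: "gradient_field g \<Longrightarrow> gradient_field (\<lambda>x. - g x)"
  unfolding gradient_field_def by simp

section \<open>The spaces \<open>L\<^sup>q\<close>\<close>

lemma Lq_bounded_linear:
  fixes f :: "real^3 \<Rightarrow> 'b::euclidean_space" and T :: "'b \<Rightarrow> 'c::euclidean_space"
  assumes T: "bounded_linear T" and q: "0 \<le> q" and f: "f \<in> Lq q"
  shows "(\<lambda>x. T (f x)) \<in> Lq q"
proof -
  obtain K where K: "0 \<le> K" "\<And>y. norm (T y) \<le> norm y * K"
    using bounded_linear.nonneg_bounded[OF T] by blast
  have f': "f \<in> borel_measurable lebesgue" "integrable lebesgue (\<lambda>x. norm (f x) powr q)"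
    using f by (auto simp: Lq_def)
  have Tf: "(\<lambda>x. T (f x)) \<in> borel_measurable lebesgue"
    by (intro measurable_compose[OF f'(1)] borel_measurable_continuous_onI
        linear_continuous_on T)
  have "integrable lebesgue (\<lambda>x. norm (T (f x)) powr q)"
  proof (rule Bochner_Integration.integrable_bound[OF integrable_mult_left[OF f'(2), of "K powr q"]])
    show "AE x in lebesgue. norm (norm (T (f x)) powr q) \<le> norm (norm (f x) powr q * K powr q)"
      using K q by (auto simp: powr_mult[symmetric] intro!: powr_mono2)
  qed (use Tf in measurable)
  with Tf show ?thesis
    by (simp add: Lq_def)
qed

lemma powr_add_le:
  fixes a b q :: real
  assumes q: "1 \<le> q" and "0 \<le> a" "0 \<le> b"
  shows "(a + b) powr q \<le> 2 powr q / 2 * (a powr q + b powr q)"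
proof (cases "a = 0 \<or> b = 0")
  case True
  have "2 powr 1 \<le> 2 powr q"
    using q by (intro powr_mono) auto
  then have "c powr q \<le> 2 powr q / 2 * c powr q" for c :: real
    using mult_right_mono[of 1 "2 powr q / 2" "c powr q"] by simp
  then show ?thesis
    using True q by auto
next
  case False
  then have "0 < a" "0 < b" using assms by auto
  then have "((1/2) * a + (1/2) * b) powr q \<le> (1/2) * a powr q + (1/2) * b powr q"
    using convex_onD[OF powr_convex[OF q], of "1/2" a b] by simp
  moreover have "((1/2) * a + (1/2) * b) powr q = (a + b) powr q / 2 powr q"
    using \<open>0 < a\<close> \<open>0 < b\<close> by (simp add: powr_divide add_divide_distrib[symmetric])
  ultimately have "(a + b) powr q / 2 powr q \<le> (a powr q + b powr q) / 2"
    by argo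
  then show ?thesis
    by (simp add: divide_le_eq mult.commute)
qed

text \<open>
  When both norms have a common bound \<open>C\<close>, Minkowski's inequality reduces to the midpoint convexity
  of \<open>t \<mapsto> t\<^sup>q\<close>: the integral of \<open>|f + g|\<^sup>q\<close> is at most \<open>2\<^sup>q/2 \<cdot> (C\<^sup>q + C\<^sup>q) = (2C)\<^sup>q\<close>.
\<close>

lemma Lq_add:
  fixes f g :: "real^3 \<Rightarrow> 'b::euclidean_space"
  assumes q: "1 \<le> q" and f: "f \<in> Lq q" and g: "g \<in> Lq q"
  shows Lq_add_mem: "(\<lambda>x. f x + g x) \<in> Lq q"
    and Lq_norm_add_le: "Lq_norm q f \<le> C \<Longrightarrow> Lq_norm q g \<le> C \<Longrightarrow> Lq_norm q (\<lambda>x. f x + g x) \<le> 2 * C"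
proof -
  have f': "f \<in> borel_measurable lebesgue" "integrable lebesgue (\<lambda>x. norm (f x) powr q)"
    and g': "g \<in> borel_measurable lebesgue" "integrable lebesgue (\<lambda>x. norm (g x) powr q)"
    using f g by (auto simp: Lq_def)
  let ?b = "\<lambda>x. 2 powr q / 2 * (norm (f x) powr q + norm (g x) powr q)"
  have b: "integrable lebesgue ?b"
    using f' g' by simp
  have le: "norm (f x + g x) powr q \<le> ?b x" for x
  proof -
    have "norm (f x + g x) powr q \<le> (norm (f x) + norm (g x)) powr q"
      using q by (intro powr_mono2 norm_triangle_ineq) auto
    also have "\<dots> \<le> ?b x"
      using q by (intro powr_add_le) auto
    finally show ?thesis .
  qed
  have fg: "(\<lambda>x. f x + g x) \<in> borel_measurable lebesgue"
    using f' g' by measurable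
  have int: "integrable lebesgue (\<lambda>x. norm (f x + g x) powr q)"
  proof (rule Bochner_Integration.integrable_bound[OF b])
    show "AE x in lebesgue. norm (norm (f x + g x) powr q) \<le> norm (?b x)"
      using le by (intro AE_I2) (simp add: order_trans[OF _ abs_ge_self])
  qed (use fg in measurable)
  with fg show "(\<lambda>x. f x + g x) \<in> Lq q"
    by (simp add: Lq_def)
  assume C: "Lq_norm q f \<le> C" "Lq_norm q g \<le> C"
  have "0 \<le> C"
    using C(1) by (rule order_trans[rotated]) (simp add: Lq_norm_def)
  have bound: "(\<integral>x. norm (h x) powr q \<partial>lebesgue) \<le> C powr q" if "Lq_norm q h \<le> C"
    for h :: "real^3 \<Rightarrow> 'b"
  proof -
    have "(\<integral>x. norm (h x) powr q \<partial>lebesgue) = Lq_norm q h powr q"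
      using q by (simp add: Lq_norm_def powr_powr)
    also have "\<dots> \<le> C powr q"
      using that q by (intro powr_mono2) (auto simp: Lq_norm_def)
    finally show ?thesis .
  qed
  have "(\<integral>x. norm (f x + g x) powr q \<partial>lebesgue) \<le> (\<integral>x. ?b x \<partial>lebesgue)"
    by (intro integral_mono int b le)
  also have "\<dots> = 2 powr q / 2 *
      ((\<integral>x. norm (f x) powr q \<partial>lebesgue) + (\<integral>x. norm (g x) powr q \<partial>lebesgue))"
    using f' g' by simp
  also have "\<dots> \<le> 2 powr q / 2 * (C powr q + C powr q)"
    using C by (intro mult_left_mono add_mono bound) auto
  also have "\<dots> = (2 * C) powr q"
    using \<open>0 \<le> C\<close> by (simp add: powr_mult)
  finally have "Lq_norm q (\<lambda>x. f x + g x) \<le> ((2 * C) powr q) powr (1 / q)"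
    unfolding Lq_norm_def using q by (intro powr_mono2) auto
  also have "\<dots> = 2 * C"
    using q \<open>0 \<le> C\<close> by (simp add: powr_powr)
  finally show "Lq_norm q (\<lambda>x. f x + g x) \<le> 2 * C" .
qed

lemma Lq_norm_cong_AE:
  fixes f g :: "real^3 \<Rightarrow> 'b::euclidean_space"
  assumes "f \<in> Lq q" "g \<in> Lq q" "AE x in lebesgue. f x = g x"
  shows "Lq_norm q f = Lq_norm q g"
proof -
  have "(\<integral>x. norm (f x) powr q \<partial>lebesgue) = (\<integral>x. norm (g x) powr q \<partial>lebesgue)"
    using assms by (intro integral_cong_AE) (auto simp: Lq_def)
  then show ?thesis
    by (simp add: Lq_norm_def)
qed

section \<open>Consequences of the Helmholtz decomposition\<close>

text \<open>
  The hypothesis bounds one decomposition; uniqueness carries the bounds over to any decomposition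
  found by other means.
\<close>

lemma helmholtz_const_bounds:
  assumes B: "helmholtz_const q B" and v: "v \<in> Lq q" and d: "helmholtz_decomp q v w g"
  shows "Lq_norm q w \<le> B * Lq_norm q v" "Lq_norm q g \<le> B * Lq_norm q v"
proof -
  obtain w0 g0 where 0: "helmholtz_decomp q v w0 g0"
    "Lq_norm q w0 \<le> B * Lq_norm q v" "Lq_norm q g0 \<le> B * Lq_norm q v"
    "AE x in lebesgue. w x = w0 x" "AE x in lebesgue. g x = g0 x"
    using B v d unfolding helmholtz_const_def by meson
  moreover have "w \<in> Lq q" "g \<in> Lq q" "w0 \<in> Lq q" "g0 \<in> Lq q"
    using d 0(1) by (auto simp: helmholtz_decomp_def)
  ultimately show "Lq_norm q w \<le> B * Lq_norm q v" "Lq_norm q g \<le> B * Lq_norm q v"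
    using Lq_norm_cong_AE by metis+
qed

text \<open>
  In general \<open>\<parallel>w + g\<parallel> \<le> \<parallel>w\<parallel> + \<parallel>g\<parallel>\<close> cannot be reversed, but \<open>w\<close> and \<open>-g\<close> are the
  Helmholtz parts of \<open>w - g\<close>, so each of them is controlled by this difference.
\<close>

lemma Lq_norm_plus_le_minus:
  fixes w g :: "real^3 \<Rightarrow> real^3"
  assumes q: "1 \<le> q" and B: "helmholtz_const q B"
    and w: "w \<in> Lq q" "weakly_div_free w" and g: "g \<in> Lq q" "gradient_field g"
  shows "Lq_norm q (\<lambda>x. w x + g x) \<le> 2 * B * Lq_norm q (\<lambda>x. w x - g x)"
proof -
  have minus_g: "(\<lambda>x. - g x) \<in> Lq q"
    using g(1) by (simp add: Lq_def)
  have "helmholtz_decomp q (\<lambda>x. w x - g x) w (\<lambda>x. - g x)"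
    using w g minus_g by (simp add: helmholtz_decomp_def gradient_field_minus)
  moreover have "(\<lambda>x. w x - g x) \<in> Lq q"
    using Lq_add_mem[OF q w(1) minus_g] by simp
  ultimately have "Lq_norm q w \<le> B * Lq_norm q (\<lambda>x. w x - g x)"
    "Lq_norm q (\<lambda>x. - g x) \<le> B * Lq_norm q (\<lambda>x. w x - g x)"
    using helmholtz_const_bounds[OF B] by blast+
  moreover have "Lq_norm q (\<lambda>x. - g x) = Lq_norm q g"
    by (simp add: Lq_norm_def)
  ultimately show ?thesis
    using Lq_norm_add_le[OF q w(1) g(1), of "B * Lq_norm q (\<lambda>x. w x - g x)"]
    by (simp add: mult.assoc)
qed

section \<open>The fields derived from \<open>u\<close>\<close>

lemma has_weak_partial_weak_partial:
  "has_weak_partial j f g \<Longrightarrow> has_weak_partial j f (weak_partial j f)"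
  unfolding weak_partial_def by (rule someI[of "has_weak_partial j f"])

lemma norm_omega_h:
  "norm (omega_h u x) = norm (weak_partial_vec 3 u x - weak_gradient (\<lambda>y. u y $ 3) x)"
  by (simp add: norm_vec_def L2_set_def sum_3 omega_h_def weak_curl_def weak_partial_vec_def
      weak_gradient_def power2_commute add.commute)

theorem proposition3p6:
  fixes q B\<^sub>q :: real
  assumes "1 < q"
    and "helmholtz_const q B\<^sub>q"
  shows "\<forall>u \<in> hom_sobolev_df q.
           1 / (2 * B\<^sub>q) * Lq_norm q (omega_h u) \<le> Lq_norm q (v3 u) \<and>
           Lq_norm q (v3 u) \<le> 2 * B\<^sub>q * Lq_norm q (omega_h u)"
proof
  fix u :: "real^3 \<Rightarrow> real^3" assume u: "u \<in> hom_sobolev_df q"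
  define P where "P = weak_partial_vec 3 u"
  define G where "G = weak_gradient (\<lambda>y. u y $ 3)"
  have q: "1 \<le> q" "0 \<le> q" using \<open>1 < q\<close> by auto
  have J: "weak_jacobian u \<in> Lq q" and div: "weakly_div_free u"
    and weak: "has_weak_partial j (\<lambda>x. u x $ i) (weak_partial j (\<lambda>x. u x $ i))" for i j
    using u has_weak_partial_weak_partial unfolding hom_sobolev_df_def by blast+

  \<comment> \<open>\<open>P\<close> is the third column and \<open>G\<close> the third row of the Jacobian matrix of \<open>u\<close>.\<close>
  have "bounded_linear (\<lambda>M::real^3^3. \<chi> i. M $ i $ 3)"
    by (intro linear_conv_bounded_linear[THEN iffD1] linearI) (simp_all add: vec_eq_iff)
  from Lq_bounded_linear[OF this q(2) J] have P: "P \<in> Lq q"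
    by (simp add: P_def weak_partial_vec_def[abs_def] weak_jacobian_def)
  from Lq_bounded_linear[OF bounded_linear_vec_nth[of 3] q(2) J] have G: "G \<in> Lq q"
    by (simp add: G_def weak_gradient_def[abs_def] weak_jacobian_def)
  have P_div: "weakly_div_free P"
    by (rule weakly_div_free_weak_partial[OF div, of 3])
      (simp add: P_def weak_partial_vec_def weak)
  have G_grad: "gradient_field G"
    by (rule gradient_field_weak_gradient[of "\<lambda>y. u y $ 3"])
      (simp add: G_def weak_gradient_def weak)

  have v3: "Lq_norm q (v3 u) = Lq_norm q (\<lambda>x. P x + G x)"
    by (simp add: Lq_norm_def v3_def P_def G_def)
  have omega: "Lq_norm q (omega_h u) = Lq_norm q (\<lambda>x. P x - G x)"
    by (simp add: Lq_norm_def norm_omega_h P_def G_def)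
  have "Lq_norm q (v3 u) \<le> 2 * B\<^sub>q * Lq_norm q (omega_h u)"
    unfolding v3 omega by (rule Lq_norm_plus_le_minus[OF q(1) assms(2) P P_div G G_grad])
  moreover have "Lq_norm q (omega_h u) \<le> 2 * B\<^sub>q * Lq_norm q (v3 u)"
    using Lq_norm_plus_le_minus[OF q(1) assms(2) P P_div _ gradient_field_minus[OF G_grad]] G
    unfolding v3 omega by (simp add: Lq_def)
  moreover have "1 \<le> B\<^sub>q"
    using assms(2) by (simp add: helmholtz_const_def)
  ultimately show "1 / (2 * B\<^sub>q) * Lq_norm q (omega_h u) \<le> Lq_norm q (v3 u) \<and>
           Lq_norm q (v3 u) \<le> 2 * B\<^sub>q * Lq_norm q (omega_h u)"
    by (simp add: field_simps)
qed

end
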